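(* Let $n\ge 1$ and let $\mathcal{C}$ be an additive $(n,2^n)$ code over $\mathrm{GF}(4)$ with $n\times n$ generator matrix $C$. Write $C = A+\omega B$ with $A,B$ binary $n\times n$ matrices, with columns $\boldsymbol{a}_1,\dots,\boldsymbol{a}_n$ and $\boldsymbol{b}_1,\dots,\boldsymbol{b}_n$ respectively. Then there exists a directed graph code equivalent to $\mathcal{C}$, except when $C$ is such that all $2^n$ choices of $n$ columns $(\boldsymbol{c}_1,\dots,\boldsymbol{c}_n)$ of $(A\mid B)$ with $\boldsymbol{c}_i\in\{\boldsymbol{a}_i,\boldsymbol{b}_i\}$ for each $i$ are linearly dependent over $\mathrm{GF}(2)$. (That is: if at least one of these $2^n$ choices is linearly independent over $\mathrm{GF}(2)$, then $\mathcal{C}$ is equivalent to a directed graph code.)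
   Context: $\mathrm{GF}(4)=\{0,1,\omega,\omega^2\}$ with $\omega^2=\omega+1$. An additive $(n,2^k)$ code over $\mathrm{GF}(4)$ is an additive subgroup of $\mathrm{GF}(4)^n$ with $2^k$ elements; a generator matrix of it is a $k\times n$ matrix over $\mathrm{GF}(4)$ whose rows span the code additively (i.e. over $\mathrm{GF}(2)$). Two additive codes of length $n$ are equivalent if one is mapped onto the other by a permutation of coordinates, followed by multiplication of individual coordinates by nonzero elements of $\mathrm{GF}(4)$, followed by conjugation $x\mapsto\overline{x}=x^2$ of some (possibly none) of the coordinates. A directed graph code is an additive $(n,2^n)$ code having a generator matrix of the form $\Gamma+\omega I$, where $I$ is the $n \times n$ identity matrix and $\Gamma$ is the adjacency matrix of a simple directed graph on $n$ vertices, i.e. an $n\times n$ $\{0,1\}$-matrix (not necessarily symmetric) with zero diagonal. *)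

theory Defs
  imports "HOL-Analysis.Analysis" "HOL-Library.Z2"
begin

section \<open>The field GF(4)\<close>

text \<open>The element \<open>GF4 a b\<close> stands for \<open>a + \<omega> b\<close>, where \<open>\<omega>\<^sup>2 = \<omega> + 1\<close>.\<close>

datatype gf4 = GF4 bit bit

instantiation gf4 :: field
begin

definition "0 = GF4 0 0"

definition "1 = GF4 1 0"

fun plus_gf4 where
  "GF4 a b + GF4 c d = GF4 (a + c) (b + d)"

definition uminus_gf4 where
  "- (x::gf4) = x"

definition minus_gf4 where
  "x - (y::gf4) = x + y"

fun times_gf4 where
  "GF4 a b * GF4 c d = GF4 (a * c + b * d) (a * d + b * c + b * d)"

text \<open>Since \<open>x\<^sup>3 = 1\<close> for \<open>x \<noteq> 0\<close>, the inverse of \<open>x\<close> is its square.\<close>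

definition inverse_gf4 where
  "inverse (x::gf4) = x * x"

definition divide_gf4 where
  "x div (y::gf4) = x * inverse y"

instance
proof
  fix a b c :: gf4
  show "a + b + c = a + (b + c)"
    by (cases a; cases b; cases c) (simp add: ac_simps del: add_bit_eq_xor)
  show "a + b = b + a"
    by (cases a; cases b) (simp add: ac_simps del: add_bit_eq_xor)
  show "0 + a = a"
    by (cases a) (simp add: zero_gf4_def del: add_bit_eq_xor)
  show "- a + a = 0"
    by (cases a) (auto simp: uminus_gf4_def zero_gf4_def)
  show "a - b = a + - b"
    by (simp add: minus_gf4_def uminus_gf4_def)
  show "a * b * c = a * (b * c)"
    by (cases a; cases b; cases c)
      (simp add: algebra_simps del: add_bit_eq_xor mult_bit_eq_and)
  show "a * b = b * a"
    by (cases a; cases b)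
      (simp add: algebra_simps del: add_bit_eq_xor mult_bit_eq_and)
  show "1 * a = a"
    by (cases a) (simp add: one_gf4_def del: add_bit_eq_xor mult_bit_eq_and)
  show "(a + b) * c = a * c + b * c"
    by (cases a; cases b; cases c)
      (simp add: algebra_simps del: add_bit_eq_xor mult_bit_eq_and)
  show "(0::gf4) \<noteq> 1"
    by (simp add: zero_gf4_def one_gf4_def)
  show "inverse a * a = 1" if "a \<noteq> 0"
  proof -
    obtain x y where "a = GF4 x y"
      by (cases a)
    with that show ?thesis
      by (cases x; cases y) (simp_all add: inverse_gf4_def zero_gf4_def one_gf4_def)
  qed
  show "a div b = a * inverse b"
    by (rule divide_gf4_def)
  show "inverse (0::gf4) = 0"
    by (simp add: inverse_gf4_def zero_gf4_def)
qed

end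

definition omega :: gf4  (\<open>\<omega>\<close>) where
  "\<omega> = GF4 0 1"

lemma omega_square: "\<omega>\<^sup>2 = \<omega> + 1"
  by (simp add: power2_eq_square omega_def one_gf4_def)

lemma gf4_eq_bits: "GF4 a b = of_bit a + \<omega> * of_bit b"
  by (cases a; cases b) (simp_all add: omega_def one_gf4_def zero_gf4_def)

lemma UNIV_gf4: "(UNIV :: gf4 set) = {0, 1, \<omega>, \<omega>\<^sup>2}"
proof -
  have "x \<in> {0, 1, \<omega>, \<omega>\<^sup>2}" for x
  proof -
    obtain a b where "x = GF4 a b"
      by (cases x)
    then show ?thesis
      by (cases a; cases b)
        (simp_all add: zero_gf4_def one_gf4_def omega_def power2_eq_square)
  qed
  then show ?thesis
    by blast
qed

lemma card_UNIV_gf4: "CARD(gf4) = 4"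
  unfolding UNIV_gf4
  by (simp add: omega_square) (simp add: omega_def zero_gf4_def one_gf4_def)

definition gf4_conj :: "gf4 \<Rightarrow> gf4" where
  "gf4_conj x = x\<^sup>2"


section \<open>Additive codes\<close>

text \<open>\<open>GF(4)\<^sup>n\<close> as a vector space over GF(2), so that \<open>gf2.span\<close> is the additive span.\<close>

interpretation gf2: vector_space "\<lambda>(b::bit) (v::gf4^'n). of_bit b *s v"
proof
  fix a b :: bit and x y :: "gf4^'n"
  show "of_bit a *s (x + y) = of_bit a *s x + of_bit a *s y"
    by (rule vec.scale_right_distrib)
  have "of_bit (a + b) = (of_bit a + of_bit b :: gf4)"
    by (cases a; cases b) (simp_all add: zero_gf4_def one_gf4_def)
  then show "of_bit (a + b) *s x = of_bit a *s x + of_bit b *s x"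
    by (simp only: vec.scale_left_distrib)
  show "of_bit a *s (of_bit b *s x) = of_bit (a * b) *s x"
    by (cases a; cases b) simp_all
  show "of_bit 1 *s x = x"
    by simp
qed

definition additive_subgroup :: "'a::ab_group_add set \<Rightarrow> bool" where
  "additive_subgroup H \<longleftrightarrow>
     0 \<in> H \<and> (\<forall>x\<in>H. \<forall>y\<in>H. x + y \<in> H) \<and> (\<forall>x\<in>H. - x \<in> H)"

text \<open>An additive \<open>(n, 2\<^sup>k)\<close> code, where \<open>n\<close> is the cardinality of the index type.\<close>

definition additive_code :: "nat \<Rightarrow> (gf4^'n) set \<Rightarrow> bool" where
  "additive_code k \<C> \<longleftrightarrow> additive_subgroup \<C> \<and> card \<C> = 2 ^ k"

definition generator_matrix :: "gf4^'n^'k \<Rightarrow> (gf4^'n) set \<Rightarrow> bool" where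
  "generator_matrix M \<C> \<longleftrightarrow> gf2.span (rows M) = \<C>"

text \<open>The matrix \<open>A + \<omega> B\<close> over GF(4), for binary matrices \<open>A\<close> and \<open>B\<close>.\<close>

definition gf4_matrix :: "bit^'n^'m \<Rightarrow> bit^'n^'m \<Rightarrow> gf4^'n^'m" where
  "gf4_matrix A B = (\<chi> i j. of_bit (A $ i $ j) + \<omega> * of_bit (B $ i $ j))"


section \<open>Equivalence of codes\<close>

definition permute_coords :: "('n \<Rightarrow> 'n) \<Rightarrow> gf4^'n \<Rightarrow> gf4^'n" where
  "permute_coords p v = (\<chi> i. v $ p i)"

definition scale_coords :: "('n \<Rightarrow> gf4) \<Rightarrow> gf4^'n \<Rightarrow> gf4^'n" where
  "scale_coords d v = (\<chi> i. d i * v $ i)"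

definition conj_coords :: "'n set \<Rightarrow> gf4^'n \<Rightarrow> gf4^'n" where
  "conj_coords S v = (\<chi> i. if i \<in> S then gf4_conj (v $ i) else v $ i)"

definition code_equiv :: "(gf4^'n) set \<Rightarrow> (gf4^'n) set \<Rightarrow> bool" where
  "code_equiv \<C> \<D> \<longleftrightarrow>
     (\<exists>p d S. bij p \<and> (\<forall>i. d i \<noteq> 0) \<and>
        (conj_coords S \<circ> scale_coords d \<circ> permute_coords p) ` \<C> = \<D>)"


section \<open>Directed graph codes\<close>

definition digraph_adjacency :: "bit^'n^'n \<Rightarrow> bool" where
  "digraph_adjacency \<Gamma> \<longleftrightarrow> (\<forall>i. \<Gamma> $ i $ i = 0)"

definition directed_graph_code :: "(gf4^'n) set \<Rightarrow> bool" where
  "directed_graph_code \<C> \<longleftrightarrow>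
     additive_code CARD('n) \<C> \<and>
     (\<exists>\<Gamma> :: bit^'n^'n. digraph_adjacency \<Gamma> \<and> generator_matrix (gf4_matrix \<Gamma> (mat 1)) \<C>)"


section \<open>Linear dependence\<close>

text \<open>
  Dependence of a family rather than of a set of vectors: a family with a repeated member is
  dependent even if the set of its members is independent.
\<close>

definition lin_dep_family :: "('m::finite \<Rightarrow> 'a::field^'n) \<Rightarrow> bool" where
  "lin_dep_family c \<longleftrightarrow> (\<exists>x. (\<exists>i. x i \<noteq> 0) \<and> (\<Sum>i\<in>UNIV. x i *s c i) = 0)"

lemma lin_dep_family_iff:
  "lin_dep_family c \<longleftrightarrow> \<not> inj c \<or> vec.dependent (range c)"
proof (cases "inj c")
  case True
  have "vec.dependent (range c) \<longleftrightarrow> (\<exists>u. (\<exists>v\<in>range c. u v \<noteq> 0) \<and> (\<Sum>v\<in>range c. u v *s v) = 0)"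
    by (rule vec.dependent_finite) simp
  also have "\<dots> \<longleftrightarrow> (\<exists>u. (\<exists>i. u (c i) \<noteq> 0) \<and> (\<Sum>i\<in>UNIV. u (c i) *s c i) = 0)"
    by (simp add: sum.reindex[OF True] o_def)
  also have "\<dots> \<longleftrightarrow> lin_dep_family c"
  proof
    assume "lin_dep_family c"
    then obtain x where x: "\<exists>i. x i \<noteq> 0" "(\<Sum>i\<in>UNIV. x i *s c i) = 0"
      by (auto simp: lin_dep_family_def)
    then show "\<exists>u. (\<exists>i. u (c i) \<noteq> 0) \<and> (\<Sum>i\<in>UNIV. u (c i) *s c i) = 0"
      by (intro exI[of _ "x \<circ> inv c"]) (simp add: inv_f_f[OF True])
  next
    assume "\<exists>u. (\<exists>i. u (c i) \<noteq> 0) \<and> (\<Sum>i\<in>UNIV. u (c i) *s c i) = 0"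
    then obtain u where "\<exists>i. u (c i) \<noteq> 0" "(\<Sum>i\<in>UNIV. u (c i) *s c i) = 0"
      by blast
    then show "lin_dep_family c"
      unfolding lin_dep_family_def by (intro exI[of _ "\<lambda>i. u (c i)"]) simp
  qed
  finally show ?thesis
    using True by simp
next
  case False
  then obtain i j where ij: "i \<noteq> j" "c i = c j"
    by (auto simp: inj_def)
  let ?x = "\<lambda>k. if k = i then 1 else if k = j then - 1 else 0"
  have "(\<Sum>k\<in>UNIV. ?x k *s c k) = (\<Sum>k\<in>{i, j}. ?x k *s c k)"
    by (rule sum.mono_neutral_right) auto
  also have "\<dots> = 0"
    using ij by simp
  finally have "lin_dep_family c"
    unfolding lin_dep_family_def by (intro exI[of _ ?x]) (auto intro: exI[of _ i])
  with False show ?thesis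
    by simp
qed

end

theory Submission
  imports Defs
begin

text \<open>
  The coordinate maps of a code equivalence permute \<open>1, \<omega>, \<omega>\<^sup>2\<close> arbitrarily: \<open>x \<mapsto> conj (\<omega>\<^sup>2 x)\<close>
  exchanges \<open>a\<^sub>i\<close> and \<open>b\<^sub>i\<close>, and conjugation replaces \<open>a\<^sub>i\<close> by \<open>a\<^sub>i + b\<^sub>i\<close>. Exchanges turn the
  independent choice of columns into the \<open>\<omega>\<close>-part \<open>B'\<close> of the generator matrix \<open>A' + \<omega> B'\<close>.
  Row operations, that is, multiplication by \<open>R = B'\<^sup>-\<^sup>1\<close>, give \<open>R A' + \<omega> I\<close>, and conjugating the
  coordinates where the diagonal entry of \<open>R A'\<close> is 1 makes that diagonal vanish.
\<close>

lemma gf4_conj_GF4: "gf4_conj (GF4 a b) = GF4 (a + b) b"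
  by (cases a; cases b) (simp_all add: gf4_conj_def power2_eq_square)

lemma gf4_conj_add: "gf4_conj (x + y) = gf4_conj x + gf4_conj y"
  by (cases x; cases y) (simp add: gf4_conj_GF4 ac_simps del: add_bit_eq_xor)

lemma gf4_conj_0: "gf4_conj 0 = 0"
  by (simp add: gf4_conj_def)

lemma inj_gf4_conj: "inj gf4_conj"
proof (rule injI)
  fix x y assume "gf4_conj x = gf4_conj y"
  then show "x = y"
    by (cases x; cases y) (simp add: gf4_conj_GF4 del: add_bit_eq_xor)
qed

lemma omega_squared_GF4: "\<omega>\<^sup>2 = GF4 1 1"
  by (simp add: omega_def power2_eq_square)

lemma omega_square_times_GF4: "\<omega>\<^sup>2 * GF4 a b = GF4 (a + b) a"
  by (cases a; cases b) (simp_all add: omega_squared_GF4)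

lemma gf4_matrix_component: "gf4_matrix A B $ i $ j = GF4 (A $ i $ j) (B $ i $ j)"
  by (simp add: gf4_matrix_def gf4_eq_bits)

lemma of_bit_GF4: "of_bit r * GF4 a b = GF4 (r * a) (r * b)"
  by (cases r) (simp_all add: zero_gf4_def)

lemma sum_GF4: "(\<Sum>k\<in>K. GF4 (f k) (g k)) = GF4 (\<Sum>k\<in>K. f k) (\<Sum>k\<in>K. g k)"
  by (induction K rule: infinite_finite_induct) (simp_all add: zero_gf4_def del: add_bit_eq_xor)

text \<open>Linearity is over GF(2) because conjugation is additive but does not commute with
  multiplication by \<omega>. It makes these maps commute with \<open>gf2.span\<close>.\<close>

lemma linear_coord_maps:
  "Vector_Spaces.linear (\<lambda>b v. of_bit b *s v) (\<lambda>b v. of_bit b *s v)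
     (conj_coords S \<circ> scale_coords d \<circ> permute_coords p)"
    (is "Vector_Spaces.linear _ _ ?T")
proof -
  have "?T (x + y) = ?T x + ?T y" for x y
    by (simp add: vec_eq_iff conj_coords_def scale_coords_def permute_coords_def
        gf4_conj_add distrib_left)
  moreover have "?T (of_bit b *s x) = of_bit b *s ?T x" for b x
    by (cases b)
      (simp_all add: vec_eq_iff conj_coords_def scale_coords_def permute_coords_def gf4_conj_0)
  ultimately show ?thesis
    by (intro Vector_Spaces.linear.intro module_hom.intro module_hom_axioms.intro
        gf2.vector_space_axioms gf2.module_axioms)
qed

lemma inj_coord_maps:
  fixes p :: "'n::finite \<Rightarrow> 'n"
  assumes "bij p" "\<And>i. d i \<noteq> 0"
  shows "inj (conj_coords S \<circ> scale_coords d \<circ> permute_coords p)"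
proof (rule injI)
  fix x y :: "gf4^'n"
  assume eq: "(conj_coords S \<circ> scale_coords d \<circ> permute_coords p) x
    = (conj_coords S \<circ> scale_coords d \<circ> permute_coords p) y"
  have "d i * x $ p i = d i * y $ p i" for i
    using arg_cong[OF eq, of "\<lambda>v. v $ i"]
    by (auto simp: conj_coords_def scale_coords_def permute_coords_def
        dest: injD[OF inj_gf4_conj] split: if_splits)
  then have "x $ p i = y $ p i" for i
    using assms(2) by simp
  then show "x = y"
    using bij_is_surj[OF assms(1)] by (metis surjD vec_eq_iff)
qed

text \<open>Row \<open>i\<close> of the new matrix is the sum of the old rows weighted by the bits
  in row \<open>i\<close> of \<open>R\<close>.\<close>

lemma span_rows_gf4_matrix_mult:
  "gf2.span (rows (gf4_matrix (R ** A) (R ** B))) \<subseteq> gf2.span (rows (gf4_matrix A B))"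
proof (rule gf2.span_minimal)
  show "rows (gf4_matrix (R ** A) (R ** B)) \<subseteq> gf2.span (rows (gf4_matrix A B))"
  proof
    fix v assume "v \<in> rows (gf4_matrix (R ** A) (R ** B))"
    then obtain i where v: "v = row i (gf4_matrix (R ** A) (R ** B))"
      by (auto simp: rows_def)
    have "v = (\<Sum>k\<in>UNIV. of_bit (R $ i $ k) *s row k (gf4_matrix A B))"
      unfolding v vec_eq_iff
      by (simp only: row_def sum_component vector_smult_component vec_lambda_beta
          gf4_matrix_component matrix_matrix_mult_def of_bit_GF4 sum_GF4 simp_thms)
    moreover have "row k (gf4_matrix A B) \<in> rows (gf4_matrix A B)" for k
      by (auto simp: rows_def)
    ultimately show "v \<in> gf2.span (rows (gf4_matrix A B))"
      by (simp only:) (intro gf2.span_sum gf2.span_scale gf2.span_base)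
  qed
qed (rule gf2.subspace_span)

lemma span_rows_gf4_matrix_mult_eq:
  assumes "Q ** R = mat 1"
  shows "gf2.span (rows (gf4_matrix (R ** A) (R ** B))) = gf2.span (rows (gf4_matrix A B))"
proof (rule antisym)
  show "gf2.span (rows (gf4_matrix A B)) \<subseteq> gf2.span (rows (gf4_matrix (R ** A) (R ** B)))"
    using span_rows_gf4_matrix_mult[of Q "R ** A" "R ** B"]
    by (simp only: matrix_mul_assoc assms matrix_mul_lid)
qed (rule span_rows_gf4_matrix_mult)

text \<open>A nonzero kernel vector of the matrix with columns \<open>c j\<close> would be a
  dependence relation. The kernel is thus trivial, and for a square matrix a left inverse is
  two-sided.\<close>

lemma invertible_of_independent_family:
  fixes c :: "'n::finite \<Rightarrow> 'a::field^'n"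
  assumes "\<not> lin_dep_family c"
  shows "\<exists>R. R ** (\<chi> i j. c j $ i) = mat 1 \<and> (\<chi> i j. c j $ i) ** R = mat 1"
proof -
  let ?M = "(\<chi> i j. c j $ i) :: 'a^'n^'n"
  have "x = 0" if "?M *v x = 0" for x
  proof -
    have "(\<Sum>i\<in>UNIV. x $ i *s c i) = 0"
      using that by (simp add: matrix_mult_sum column_def)
    then show "x = 0"
      using assms unfolding lin_dep_family_def vec_eq_iff by auto
  qed
  then obtain R where "R ** ?M = mat 1"
    using matrix_left_invertible_ker[of ?M] by auto
  then show ?thesis
    using matrix_left_right_inverse[of R ?M] by auto
qed

theorem theorem1:
  fixes \<C> :: "(gf4^'n) set" and C :: "gf4^'n^'n" and A B :: "bit^'n^'n"
  assumes "additive_code CARD('n) \<C>"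
    and "generator_matrix C \<C>"
    and "C = gf4_matrix A B"
    and "\<not> (\<forall>c :: 'n \<Rightarrow> bit^'n. (\<forall>i. c i \<in> {column i A, column i B}) \<longrightarrow> lin_dep_family c)"
  shows "\<exists>\<D> :: (gf4^'n) set. directed_graph_code \<D> \<and> code_equiv \<C> \<D>"
proof -
  obtain c :: "'n \<Rightarrow> bit^'n" where c: "\<And>i. c i \<in> {column i A, column i B}"
    and indep: "\<not> lin_dep_family c"
    using assms(4) by blast
  \<comment> \<open>The coordinates to exchange; where both columns coincide, none is
    needed.\<close>
  define P where "P = {i. c i \<noteq> column i B}"
  define B' where "B' = (\<chi> i j. c j $ i)"
  obtain R where R: "R ** B' = mat 1" "B' ** R = mat 1"
    using invertible_of_independent_family[OF indep] unfolding B'_def by blast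
  define A' where "A' = (\<chi> i j. if j \<in> P then B $ i $ j else A $ i $ j)"
  have B': "B' $ i $ j = (if j \<in> P then A $ i $ j else B $ i $ j)" for i j
    using c[of j] by (auto simp: B'_def P_def column_def)
  define E where "E = {i. (R ** A') $ i $ i = 1}"
  \<comment> \<open>Conjugating coordinate \<open>j\<close> adds column \<open>j\<close> of
    \<open>B'\<close> to column \<open>j\<close> of \<open>A'\<close>. After multiplication by
    \<open>R\<close> this adds a column of the identity, so only the diagonal entry changes.\<close>
  define A'' where "A'' = (\<chi> i j. if j \<in> E then A' $ i $ j + B' $ i $ j else A' $ i $ j)"
  have RA'': "(R ** A'') $ i $ j =
      (if j \<in> E then (R ** A') $ i $ j + (R ** B') $ i $ j else (R ** A') $ i $ j)" for i j
    by (simp add: A''_def matrix_matrix_mult_def sum.distrib distrib_left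
        del: add_bit_eq_xor mult_bit_eq_and)
  \<comment> \<open>On \<open>E\<close> the diagonal entry is 1 + 1 = 0; off \<open>E\<close> it is
    a bit other than 1.\<close>
  have digraph: "digraph_adjacency (R ** A'')"
    using bit_not_one_iff by (auto simp: digraph_adjacency_def RA'' R E_def mat_def)

  define d where "d i = (if i \<in> P then \<omega>\<^sup>2 else 1)" for i
  \<comment> \<open>On \<open>P \<inter> E\<close> the conjugation of the exchange and that of the diagonal correction cancel.\<close>
  define S where "S = (P - E) \<union> (E - P)"
  define T where "T = conj_coords S \<circ> scale_coords d \<circ> permute_coords id"
  have d_nz: "d i \<noteq> 0" for i
    by (simp add: d_def omega_squared_GF4 zero_gf4_def one_gf4_def)
  have T_row: "T (row i (gf4_matrix A B)) = row i (gf4_matrix A'' B')" for i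
    unfolding vec_eq_iff
    by (auto simp: T_def conj_coords_def scale_coords_def permute_coords_def row_def
        gf4_matrix_component d_def S_def A''_def A'_def B' omega_square_times_GF4 gf4_conj_GF4
        ac_simps simp del: add_bit_eq_xor)
  have rows: "rows (gf4_matrix A'' B') = T ` rows (gf4_matrix A B)"
    by (auto simp: rows_def T_row[symmetric])
  interpret T: Vector_Spaces.linear
      "\<lambda>b v. of_bit b *s v" "\<lambda>b v. of_bit b *s v" T
    unfolding T_def by (rule linear_coord_maps)
  have "gf2.span (rows (gf4_matrix A'' B')) = T ` \<C>"
    using assms(2) by (simp only: rows T.span_image generator_matrix_def assms(3))
  \<comment> \<open>\<open>B'\<close> is the inverse of \<open>R\<close>, so these row operations
    preserve the span.\<close>
  then have span: "gf2.span (rows (gf4_matrix (R ** A'') (mat 1))) = T ` \<C>"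
    using span_rows_gf4_matrix_mult_eq[OF R(2), of A'' B'] by (simp only: R)

  have "card (T ` \<C>) = 2 ^ CARD('n)"
    using assms(1) inj_coord_maps[of id d S] d_nz
    by (simp add: T_def additive_code_def card_image inj_on_subset del: o_apply)
  \<comment> \<open>The image is a GF(2)-span, hence closed under the group operations.\<close>
  moreover have "additive_subgroup (T ` \<C>)"
    unfolding additive_subgroup_def span[symmetric]
    by (blast intro: gf2.span_zero gf2.span_add gf2.span_neg)
  ultimately have "directed_graph_code (T ` \<C>)"
    unfolding directed_graph_code_def additive_code_def generator_matrix_def
    using digraph span by blast
  moreover have "code_equiv \<C> (T ` \<C>)"
    unfolding code_equiv_def T_def using d_nz by blast
  ultimately show ?thesis
    by blast
qed

end
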